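(* Let $T$ be a nontrivial tree and let $\ell\geq 1$ be an integer. Then $pc_{1,\ell}(T)$ is equal to the maximum size (number of edges) of subtrees of $T$ with diameter $\ell+1$.
   Context: All graphs are finite, undirected and simple; a tree is nontrivial if it has at least two vertices. An edge-coloring of a graph is an arbitrary map from its edge set to the natural numbers (adjacent edges may share a color). In an edge-colored graph, a path $P$ is a distance $\ell$-proper path if no two edges of $P$ of the same color appear with fewer than $\ell$ edges in between on $P$. For a connected graph $G$, $pc_{1,\ell}(G)$ is the minimum number of colors in an edge-coloring of $G$ such that every pair of distinct vertices of $G$ is connected by at least one distance $\ell$-proper path.
   Formalization: If T has no subtree of diameter ℓ+1 (e.g. T = K_2, ℓ = 1) the maximum is over an empty set; the formal statement asserts the claim when such a subtree exists and otherwise that pc_{1,ℓ}(T) equals the number of edges of T. *)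

theory Defs
  imports Main
begin

record 'a sgraph =
  verts :: "'a set"
  edges :: "'a set set"

definition simple_graph :: "'a sgraph \<Rightarrow> bool" where
  "simple_graph G \<longleftrightarrow>
     finite (verts G) \<and>
     edges G \<subseteq> {{u, v} |u v. u \<in> verts G \<and> v \<in> verts G \<and> u \<noteq> v}"

definition is_path :: "'a sgraph \<Rightarrow> 'a list \<Rightarrow> bool" where
  "is_path G p \<longleftrightarrow>
     p \<noteq> [] \<and> set p \<subseteq> verts G \<and> distinct p \<and>
     successively (\<lambda>u v. {u, v} \<in> edges G) p"

definition path_between :: "'a sgraph \<Rightarrow> 'a \<Rightarrow> 'a list \<Rightarrow> 'a \<Rightarrow> bool" where
  "path_between G u p v \<longleftrightarrow> is_path G p \<and> hd p = u \<and> last p = v"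

(* The edges in the order in which the vertex list traverses them; zip drops the last vertex. *)
definition path_edges :: "'a list \<Rightarrow> 'a set list" where
  "path_edges p = map (\<lambda>(u, v). {u, v}) (zip p (tl p))"

definition is_cycle :: "'a sgraph \<Rightarrow> 'a list \<Rightarrow> bool" where
  "is_cycle G p \<longleftrightarrow> is_path G p \<and> length p \<ge> 3 \<and> {last p, hd p} \<in> edges G"

definition connected_graph :: "'a sgraph \<Rightarrow> bool" where
  "connected_graph G \<longleftrightarrow>
     verts G \<noteq> {} \<and> (\<forall>u\<in>verts G. \<forall>v\<in>verts G. \<exists>p. path_between G u p v)"

definition tree :: "'a sgraph \<Rightarrow> bool" where
  "tree G \<longleftrightarrow> simple_graph G \<and> connected_graph G \<and> (\<nexists>p. is_cycle G p)"

definition nontrivial_tree :: "'a sgraph \<Rightarrow> bool" where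
  "nontrivial_tree G \<longleftrightarrow> tree G \<and> card (verts G) \<ge> 2"

definition subtree :: "'a sgraph \<Rightarrow> 'a sgraph \<Rightarrow> bool" where
  "subtree S T \<longleftrightarrow> tree S \<and> verts S \<subseteq> verts T \<and> edges S \<subseteq> edges T"

definition gdist :: "'a sgraph \<Rightarrow> 'a \<Rightarrow> 'a \<Rightarrow> nat" where
  "gdist G u v = (LEAST n. \<exists>p. path_between G u p v \<and> length (path_edges p) = n)"

definition diameter :: "'a sgraph \<Rightarrow> nat" where
  "diameter G = Max {gdist G u v |u v. u \<in> verts G \<and> v \<in> verts G}"

definition graph_size :: "'a sgraph \<Rightarrow> nat" where
  "graph_size G = card (edges G)"

(* Between the edges at positions i < j of a path there are exactly j - i - 1 edges. *)
definition distance_proper :: "nat \<Rightarrow> ('a set \<Rightarrow> nat) \<Rightarrow> 'a list \<Rightarrow> bool" where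
  "distance_proper l c p \<longleftrightarrow>
     (\<forall>i j. i < j \<and> j < length (path_edges p) \<and>
        c (path_edges p ! i) = c (path_edges p ! j) \<longrightarrow> \<not> j - i - 1 < l)"

definition proper_connecting :: "nat \<Rightarrow> 'a sgraph \<Rightarrow> ('a set \<Rightarrow> nat) \<Rightarrow> bool" where
  "proper_connecting l G c \<longleftrightarrow>
     (\<forall>u\<in>verts G. \<forall>v\<in>verts G. u \<noteq> v \<longrightarrow>
        (\<exists>p. path_between G u p v \<and> distance_proper l c p))"

(* Only values on edges of G matter, so total functions serve as edge-colorings; the number
   of colors is the number of colors actually used on G.  Every connected simple graph
   admits such a coloring (give all edges different colors), so LEAST is a true minimum. *)
definition pc1 :: "nat \<Rightarrow> 'a sgraph \<Rightarrow> nat" where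
  "pc1 l G = (LEAST k. \<exists>c :: 'a set \<Rightarrow> nat. proper_connecting l G c \<and> card (c ` edges G) = k)"

end

theory Submission
  imports Defs
begin

text \<open>Paths in a tree are unique, so a coloring is properly connecting iff it separates any two
  edges all of whose endpoints are at distance at most \<^term>\<open>l + 1\<close>. Such a coloring is injective
  on every subtree of diameter at most \<^term>\<open>l + 1\<close>, which gives the lower bound. Conversely,
  remove a vertex \<^term>\<open>v\<close> farthest from a root, color the rest inductively and color the leaf
  edge at \<^term>\<open>v\<close> greedily: by the four-point condition the ball of radius \<^term>\<open>l + 1\<close> around
  \<^term>\<open>v\<close> is a subtree of diameter at most \<^term>\<open>l + 1\<close>, and its edges are the only ones whose
  colors matter. A largest subtree of diameter at most \<^term>\<open>l + 1\<close> is the whole tree or has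
  diameter exactly \<^term>\<open>l + 1\<close>, since adding a vertex increases the diameter by at most 1.\<close>

section \<open>Induced subgraphs and elementary facts about paths\<close>

definition induced :: "'a sgraph \<Rightarrow> 'a set \<Rightarrow> 'a sgraph" where
  "induced G W = \<lparr>verts = W, edges = {e \<in> edges G. e \<subseteq> W}\<rparr>"

lemma verts_induced [simp]: "verts (induced G W) = W"
  and edges_induced [simp]: "edges (induced G W) = {e \<in> edges G. e \<subseteq> W}"
  by (simp_all add: induced_def)

lemma simple_graph_edge:
  assumes "simple_graph G" "{u, v} \<in> edges G"
  shows "u \<in> verts G" "v \<in> verts G" "u \<noteq> v"
  using assms unfolding simple_graph_def by (auto simp: doubleton_eq_iff)

lemma simple_graph_edgeE:
  assumes "simple_graph G" "e \<in> edges G"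
  obtains u v where "e = {u, v}" "u \<in> verts G" "v \<in> verts G" "u \<noteq> v"
  using assms unfolding simple_graph_def by auto

lemma finite_edges: "simple_graph G \<Longrightarrow> finite (edges G)"
  by (rule finite_subset[of _ "Pow (verts G)"]) (auto simp: simple_graph_def)

lemma is_path_rev: "is_path G (rev p) \<longleftrightarrow> is_path G p"
  by (simp add: is_path_def insert_commute)

lemma is_path_appendD1: "is_path G (p @ q) \<Longrightarrow> p \<noteq> [] \<Longrightarrow> is_path G p"
  by (auto simp: is_path_def successively_append_iff)

lemma is_path_appendD2: "is_path G (p @ q) \<Longrightarrow> q \<noteq> [] \<Longrightarrow> is_path G q"
  by (auto simp: is_path_def successively_append_iff)

lemma is_path_mono:
  assumes "is_path S p" "verts S \<subseteq> verts T" "edges S \<subseteq> edges T"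
  shows "is_path T p"
  using assms unfolding is_path_def by (auto intro: successively_mono)

lemma is_path_append1:
  assumes "simple_graph G" "is_path G p" "{last p, y} \<in> edges G" "y \<notin> set p"
  shows "is_path G (p @ [y])"
  using assms simple_graph_edge[OF assms(1,3)]
  by (auto simp: is_path_def successively_append_iff)

lemma is_path_induced:
  assumes "is_path G p" "set p \<subseteq> W"
  shows "is_path (induced G W) p"
  using assms unfolding is_path_def
  by (auto intro: successively_mono)

lemma path_between_rev: "path_between G u p v \<Longrightarrow> path_between G v (rev p) u"
  by (auto simp: path_between_def is_path_rev hd_rev last_rev)

lemma path_between_single: "u \<in> verts G \<Longrightarrow> path_between G u [u] u"
  by (simp add: path_between_def is_path_def)

lemma path_between_edge:
  assumes "simple_graph G" "{u, v} \<in> edges G"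
  shows "path_between G u [u, v] v"
  using assms(2) simple_graph_edge[OF assms] by (simp add: path_between_def is_path_def)

lemma length_path_edges [simp]: "length (path_edges p) = length p - 1"
  by (simp add: path_edges_def)

lemma nth_path_edges: "Suc i < length p \<Longrightarrow> path_edges p ! i = {p ! i, p ! Suc i}"
  by (simp add: path_edges_def nth_tl)

section \<open>Paths in trees\<close>

lemma treeD:
  assumes "tree T"
  shows "simple_graph T" "connected_graph T" "\<not> is_cycle T p" "finite (verts T)" "finite (edges T)"
  using assms finite_edges by (auto simp: tree_def simple_graph_def)

text \<open>If two paths leave \<^term>\<open>u\<close> along different edges, following the first one up to
  its first vertex on the second one and returning along the second one is a cycle.\<close>

lemma tree_path_unique:
  assumes T: "tree T" and "path_between T u p v" "path_between T u q v"
  shows "p = q"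
  using assms(2,3)
proof (induction p arbitrary: u q)
  case Nil
  then show ?case by (simp add: path_between_def is_path_def)
next
  case (Cons x p)
  from Cons.prems have x: "x = u" by (simp add: path_between_def)
  from Cons.prems obtain q' where q: "q = u # q'"
    by (cases q) (auto simp: path_between_def is_path_def)
  show ?case
  proof (cases "p = [] \<or> q' = []")
    case True
    with Cons.prems x q show ?thesis
      by (auto simp: path_between_def is_path_def split: if_splits)
  next
    case False
    then have ne: "p \<noteq> []" "q' \<noteq> []" by auto
    have P: "path_between T (hd p) p v" and Q: "path_between T (hd q') q' v"
      and up: "{u, hd p} \<in> edges T" "{u, hd q'} \<in> edges T"
      and notin: "u \<notin> set p" "u \<notin> set q'" and uT: "u \<in> verts T"
      using Cons.prems ne x q
      by (auto simp: path_between_def is_path_def successively_Cons split: if_splits)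
    show ?thesis
    proof (cases "hd p = hd q'")
      case True
      with Cons.IH[OF P] Q x q show ?thesis by simp
    next
      case False
      have "\<exists>y\<in>set p. y \<in> set q'"
        using P Q ne by (auto simp: path_between_def intro: last_in_set)
      then obtain p1 w p2 where p: "p = p1 @ w # p2" "w \<in> set q'" "\<forall>y\<in>set p1. y \<notin> set q'"
        by (rule split_list_first_propE)
      then obtain q1 q2 where q': "q' = q1 @ w # q2" by (meson split_list)
      define C where "C = u # p1 @ w # rev q1"
      have "is_path T (q1 @ [w])"
        using Q q' is_path_appendD1[of T "q1 @ [w]" q2] by (simp add: path_between_def)
      then have "is_path T (rev (q1 @ [w]))" by (simp only: is_path_rev)
      moreover have "is_path T (p1 @ [w])"
        using P p is_path_appendD1[of T "p1 @ [w]" p2] by (simp add: path_between_def)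
      ultimately have "is_path T C"
        using notin up uT p q'
        by (auto simp: is_path_def successively_append_iff successively_Cons C_def
              hd_append split: if_splits)
      \<comment> \<open>The two paths differ right after \<open>u\<close>, so \<open>p1\<close> and
        \<open>q1\<close> are not both empty and \<open>C\<close> has a vertex besides
        \<open>u\<close> and \<open>w\<close>.\<close>
      moreover have "length C \<ge> 3"
        using False p q' by (cases p1; cases q1) (auto simp: C_def)
      moreover have "{last C, hd C} \<in> edges T"
        using up q' by (cases q1) (auto simp: C_def insert_commute)
      ultimately show ?thesis
        using treeD(3)[OF T] by (auto simp: is_cycle_def)
    qed
  qed
qed

lemma tree_path_ex:
  assumes "tree T" "u \<in> verts T" "v \<in> verts T"
  obtains p where "path_between T u p v"
  using treeD(2)[OF assms(1)] assms(2,3) unfolding connected_graph_def by blast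

text \<open>By uniqueness of paths the \<open>LEAST\<close> in \<open>gdist\<close> ranges over a
  single value.\<close>

lemma tree_gdist:
  assumes "tree T" "path_between T u p v"
  shows "gdist T u v = length p - 1"
proof -
  have "(\<exists>q. path_between T u q v \<and> length (path_edges q) = n) \<longleftrightarrow> n = length p - 1" for n
    using tree_path_unique[OF assms(1)] assms(2) by auto
  then show ?thesis unfolding gdist_def by (auto intro: Least_equality)
qed

lemma tree_gdist_sym:
  assumes "tree T" "u \<in> verts T" "v \<in> verts T"
  shows "gdist T u v = gdist T v u"
proof -
  obtain p where p: "path_between T u p v" using tree_path_ex[OF assms] .
  show ?thesis
    using tree_gdist[OF assms(1) p] tree_gdist[OF assms(1) path_between_rev[OF p]] by simp
qed

lemma tree_gdist_self: "tree T \<Longrightarrow> u \<in> verts T \<Longrightarrow> gdist T u u = 0"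
  using tree_gdist[OF _ path_between_single] by fastforce

lemma tree_gdist_edge: "tree T \<Longrightarrow> {u, v} \<in> edges T \<Longrightarrow> gdist T u v = 1"
  using tree_gdist[OF _ path_between_edge[OF treeD(1)]] by fastforce

text \<open>A segment of a path is again a path, so distances along a path in a tree are differences
  of positions.\<close>

lemma tree_gdist_nth:
  assumes T: "tree T" and p: "is_path T p" and "i \<le> j" "j < length p"
  shows "gdist T (p ! i) (p ! j) = j - i"
proof -
  define q where "q = take (Suc (j - i)) (drop i p)"
  have ne: "q \<noteq> []" using assms by (simp add: q_def)
  have "p = (take i p @ q) @ drop (Suc (j - i)) (drop i p)"
    unfolding q_def append.assoc by (simp only: append_take_drop_id)
  with p have "is_path T (take i p @ q)" by (metis is_path_appendD1 ne append_is_Nil_conv)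
  then have "is_path T q" using ne by (rule is_path_appendD2)
  moreover have "length q = Suc (j - i)" using assms by (simp add: q_def)
  moreover have "hd q = p ! i" "last q = p ! j"
    using assms ne \<open>length q = _\<close> by (simp_all add: q_def hd_conv_nth last_conv_nth)
  ultimately show ?thesis
    using tree_gdist[OF T, of "p ! i" q "p ! j"] by (simp add: path_between_def)
qed

text \<open>If \<open>y\<close> already lies on \<open>p\<close>, then the segment of
  \<open>p\<close> from \<open>y\<close> on and the single edge join the same two vertices, so
  uniqueness makes \<open>y\<close> the predecessor of \<open>last p\<close>.\<close>

lemma tree_path_step:
  assumes T: "tree T" and p: "is_path T p" and e: "{last p, y} \<in> edges T"
  shows "is_path T (p @ [y]) \<or> (\<exists>p1. p = p1 @ [y, last p])"
proof (cases "y \<in> set p")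
  case False
  then show ?thesis using is_path_append1[OF treeD(1)[OF T] p e] by simp
next
  case True
  then obtain p1 p2 where eq: "p = p1 @ y # p2" by (meson split_list)
  have "is_path T (y # p2)" using p eq is_path_appendD2 by blast
  then have "path_between T y (y # p2) (last p)" by (simp add: path_between_def eq)
  moreover have "path_between T y [y, last p] (last p)"
    using path_between_edge[OF treeD(1)[OF T]] e by (simp add: insert_commute)
  ultimately have "y # p2 = [y, last p]" using tree_path_unique[OF T] by blast
  with eq show ?thesis by auto
qed

text \<open>Join an endpoint of \<open>f\<close> to an endpoint of \<open>e\<close>. By
  \<open>tree_path_step\<close> each of the two edges either prolongs the path at its end or is
  already its end edge.\<close>

lemma tree_path_through_edges:
  assumes T: "tree T" and e: "e \<in> edges T" and f: "f \<in> edges T" and "e \<noteq> f"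
  obtains p where "is_path T p" "length p \<ge> 3"
    "path_edges p ! 0 = e" "path_edges p ! (length p - 2) = f"
proof -
  obtain a b where ab: "e = {a, b}" "a \<in> verts T"
    using simple_graph_edgeE[OF treeD(1)[OF T] e] by metis
  obtain x y where xy: "f = {x, y}" "x \<in> verts T"
    using simple_graph_edgeE[OF treeD(1)[OF T] f] by metis
  \<comment> \<open>The path is oriented with \<open>e\<close> in front; \<open>s\<close> and
    \<open>t\<close> are the endpoints of \<open>e\<close> in whichever order the path meets
    them.\<close>
  have "\<exists>p s t r. is_path T p \<and> last p = x \<and> p = s # t # r \<and> e = {s, t}"
  proof -
    obtain p where p: "path_between T x p a" using tree_path_ex[OF T xy(2) ab(2)] .
    then have l: "last p = a" "is_path T p" "hd p = x" "p \<noteq> []"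
      by (auto simp: path_between_def is_path_def)
    have "is_path T (p @ [b]) \<or> (\<exists>p1. p = p1 @ [b, a])"
      using tree_path_step[OF T l(2)] l(1) e ab by auto
    then show ?thesis
    proof
      assume "is_path T (p @ [b])"
      then have "is_path T (rev (p @ [b]))" by (simp only: is_path_rev)
      moreover have "rev (p @ [b]) = b # a # tl (rev p)"
        using l by (cases p rule: rev_cases) auto
      moreover have "last (rev (p @ [b])) = x" using l by (simp add: last_rev)
      ultimately show ?thesis using ab(1) by (metis insert_commute)
    next
      assume "\<exists>p1. p = p1 @ [b, a]"
      then obtain p1 where "p = p1 @ [b, a]" by blast
      then have "rev p = a # b # rev p1" by simp
      moreover have "is_path T (rev p)" "last (rev p) = x"
        using l by (simp_all add: is_path_rev last_rev)
      ultimately show ?thesis using ab(1) by metis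
    qed
  qed
  then obtain p s t r where p: "is_path T p" "last p = x" "p = s # t # r" "e = {s, t}"
    by blast
  have e0: "path_edges (p @ q) ! 0 = e" for q using p by (simp add: nth_path_edges)
  from tree_path_step[OF T p(1), of y] p(2) f xy
  consider "is_path T (p @ [y])" | p1 where "p = p1 @ [y, x]" by auto
  then show ?thesis
  proof cases
    case 1
    have "p \<noteq> []" using p by simp
    then have "path_edges (p @ [y]) ! (length p - 1) = f"
      using p(2) xy(1) by (simp add: nth_path_edges nth_append last_conv_nth)
    with 1 show ?thesis using that[of "p @ [y]"] e0[of "[y]"] p by simp
  next
    case 2
    have "path_edges p ! (length p - 2) = f"
      using 2 xy by (auto simp: nth_path_edges nth_append)
    \<comment> \<open>On a path with only two vertices, the first and the last edge would coincide,
      against \<open>e \<noteq> f\<close>.\<close>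
    moreover have "length p \<ge> 3"
    proof (rule ccontr)
      assume "\<not> length p \<ge> 3"
      with p(3) have "p = [s, t]" by (cases r) auto
      with 2 have "s = y" "t = x" by (auto simp: append_eq_Cons_conv)
      with p(4) xy(1) \<open>e \<noteq> f\<close> show False by auto
    qed
    ultimately show ?thesis using that[of p] e0[of "[]"] p by simp
  qed
qed

section \<open>Subtrees\<close>

lemma subtreeD:
  assumes "subtree S T"
  shows "tree S" "verts S \<subseteq> verts T" "edges S \<subseteq> edges T"
  using assms by (auto simp: subtree_def)

lemma subtree_trans: "subtree R S \<Longrightarrow> subtree S T \<Longrightarrow> subtree R T"
  by (auto simp: subtree_def)

lemma path_between_subtree:
  "subtree S T \<Longrightarrow> path_between S u p v \<Longrightarrow> path_between T u p v"
  using is_path_mono[of S p T] subtreeD[of S T] by (simp add: path_between_def)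

text \<open>A path in \<open>S\<close> is also the unique path in \<open>T\<close> between its ends,
  so subtrees are isometric.\<close>

lemma subtree_gdist:
  assumes "tree T" "subtree S T" "u \<in> verts S" "v \<in> verts S"
  shows "gdist S u v = gdist T u v"
proof -
  obtain p where p: "path_between S u p v"
    using tree_path_ex[OF subtreeD(1)[OF assms(2)] assms(3,4)] .
  show ?thesis
    using tree_gdist[OF subtreeD(1)[OF assms(2)] p]
      tree_gdist[OF assms(1) path_between_subtree[OF assms(2) p]] by simp
qed

text \<open>Closure of \<open>W\<close> under paths of \<open>T\<close> yields connectedness;
  acyclicity is inherited from \<open>T\<close>.\<close>

lemma subtree_induced:
  assumes T: "tree T" and W: "W \<subseteq> verts T" "W \<noteq> {}"
    and conv: "\<And>u v p. u \<in> W \<Longrightarrow> v \<in> W \<Longrightarrow> path_between T u p v \<Longrightarrow> set p \<subseteq> W"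
  shows "subtree (induced T W) T"
proof -
  have "simple_graph (induced T W)"
  proof -
    have "e \<in> {{u, v} |u v. u \<in> W \<and> v \<in> W \<and> u \<noteq> v}" if e: "e \<in> edges T" "e \<subseteq> W" for e
    proof -
      obtain u v where "e = {u, v}" "u \<noteq> v"
        using simple_graph_edgeE[OF treeD(1)[OF T] e(1)] by metis
      with e(2) show ?thesis by blast
    qed
    then show ?thesis
      using finite_subset[OF W(1) treeD(4)[OF T]] by (auto simp: simple_graph_def)
  qed
  moreover have "connected_graph (induced T W)"
  proof -
    have "\<exists>p. path_between (induced T W) u p v" if uv: "u \<in> W" "v \<in> W" for u v
    proof -
      obtain p where p: "path_between T u p v"
        using tree_path_ex[OF T] W(1) uv by (metis subsetD)
      then have "path_between (induced T W) u p v"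
        using is_path_induced[of T p W] conv[OF uv p] by (simp add: path_between_def)
      then show ?thesis ..
    qed
    with W show ?thesis by (simp add: connected_graph_def)
  qed
  moreover have "\<not> is_cycle (induced T W) p" for p
  proof
    assume "is_cycle (induced T W) p"
    then have "is_cycle T p"
      using is_path_mono[of "induced T W" p T] W(1) by (simp add: is_cycle_def subset_iff)
    with treeD(3)[OF T] show False ..
  qed
  ultimately have "tree (induced T W)" unfolding tree_def by blast
  with W(1) show ?thesis by (simp add: subtree_def subset_iff)
qed

lemma tree_diameter_le_iff:
  assumes T: "tree T"
  shows "diameter T \<le> n \<longleftrightarrow> (\<forall>u\<in>verts T. \<forall>v\<in>verts T. gdist T u v \<le> n)"
proof -
  have "{gdist T u v |u v. u \<in> verts T \<and> v \<in> verts T}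
      = (\<lambda>(u, v). gdist T u v) ` (verts T \<times> verts T)" by auto
  moreover have "verts T \<noteq> {}" using treeD(2)[OF T] by (simp add: connected_graph_def)
  ultimately show ?thesis
    unfolding diameter_def using treeD(4)[OF T] by (auto simp: Max_le_iff)
qed

lemma subtree_diameter_le:
  assumes "tree T" "subtree S T"
  shows "diameter S \<le> diameter T"
proof -
  have "\<forall>u\<in>verts T. \<forall>v\<in>verts T. gdist T u v \<le> diameter T"
    using tree_diameter_le_iff[OF assms(1)] by blast
  then show ?thesis
    using tree_diameter_le_iff[OF subtreeD(1)[OF assms(2)]] subtree_gdist[OF assms]
      subtreeD(2)[OF assms(2)] by (simp add: subset_iff)
qed

text \<open>For an edge of \<open>T\<close>, the path in \<open>S\<close> between its endpoints must
  by uniqueness be that edge itself.\<close>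

lemma subtree_eq_if_verts_eq:
  assumes T: "tree T" and S: "subtree S T" and eq: "verts S = verts T"
  shows "S = T"
proof -
  have "e \<in> edges S" if e: "e \<in> edges T" for e
  proof -
    obtain u v where uv: "e = {u, v}" "u \<in> verts T" "v \<in> verts T"
      using simple_graph_edgeE[OF treeD(1)[OF T] e] by metis
    obtain p where p: "path_between S u p v"
      using tree_path_ex[OF subtreeD(1)[OF S]] uv(2,3) eq by metis
    then have "p = [u, v]"
      using tree_path_unique[OF T path_between_subtree[OF S p] path_between_edge[OF treeD(1)[OF T]]]
        e uv(1) by simp
    with p uv show ?thesis by (simp add: path_between_def is_path_def)
  qed
  then have "edges S = edges T" using subtreeD(3)[OF S] by auto
  with eq show ?thesis by simp
qed

lemma finite_subtrees: "tree T \<Longrightarrow> finite {S. subtree S T}"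
proof -
  assume T: "tree T"
  have "{S. subtree S T} \<subseteq> (\<lambda>(V, E). \<lparr>verts = V, edges = E\<rparr>) ` (Pow (verts T) \<times> Pow (edges T))"
  proof
    fix S assume "S \<in> {S. subtree S T}"
    then show "S \<in> (\<lambda>(V, E). \<lparr>verts = V, edges = E\<rparr>) ` (Pow (verts T) \<times> Pow (edges T))"
      using subtreeD(2,3)[of S T] by (intro image_eqI[of _ _ "(verts S, edges S)"]) auto
  qed
  then show ?thesis by (rule finite_subset) (simp add: treeD(4,5)[OF T])
qed

section \<open>Leaves and the four-point condition\<close>

text \<open>A neighbor of \<open>v\<close> other than its predecessor on the path from
  \<open>r\<close> would be farther from \<open>r\<close> than \<open>v\<close>. So \<open>v\<close>
  is a leaf, and no path between other vertices passes through it, as that would take two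
  neighbors.\<close>

lemma tree_farthest_leaf:
  assumes T: "tree T" and card: "card (verts T) \<ge> 2" and r: "r \<in> verts T"
  obtains v w where "v \<in> verts T" "\<forall>x\<in>verts T. gdist T r x \<le> gdist T r v"
    "{v, w} \<in> edges T" "\<forall>e\<in>edges T. v \<in> e \<longrightarrow> e = {v, w}"
    "subtree (induced T (verts T - {v})) T"
proof -
  have fin: "finite (verts T)" using treeD(4)[OF T] .
  obtain v where v: "v \<in> verts T" "\<forall>x\<in>verts T. gdist T r x \<le> gdist T r v"
  proof -
    have "Max (gdist T r ` verts T) \<in> gdist T r ` verts T" using fin r by (intro Max_in) auto
    then obtain v where "v \<in> verts T" "gdist T r v = Max (gdist T r ` verts T)" by auto
    then show ?thesis using that[of v] fin by simp
  qed
  obtain p where p: "path_between T r p v" using tree_path_ex[OF T r v(1)] .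
  then have lp: "is_path T p" "last p = v" "hd p = r" "p \<noteq> []"
    by (auto simp: path_between_def is_path_def)
  have nb: "\<exists>p1. p = p1 @ [y, v]" if y: "{v, y} \<in> edges T" for y
  proof (rule ccontr)
    assume "\<not> ?thesis"
    then have "is_path T (p @ [y])" using tree_path_step[OF T lp(1)] lp(2) y by auto
    then have "path_between T r (p @ [y]) y" using lp by (simp add: path_between_def)
    from tree_gdist[OF T this] have "gdist T r y = length p" by simp
    moreover have "gdist T r v = length p - 1" using tree_gdist[OF T p] .
    moreover have "y \<in> verts T" using simple_graph_edge[OF treeD(1)[OF T] y] by blast
    moreover from this have "gdist T r y \<le> gdist T r v" using v(2) by blast
    ultimately show False using lp(4) by (cases p) simp_all
  qed
  obtain x where x: "x \<in> verts T" "x \<noteq> v"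
  proof -
    have "\<not> verts T \<subseteq> {v}" using card card_mono[of "{v}" "verts T"] by auto
    then show ?thesis using that by auto
  qed
  obtain q where q: "path_between T v q x" using tree_path_ex[OF T v(1) x(1)] .
  obtain w q' where "q = v # w # q'"
  proof (cases q rule: remdups_adj.cases)
    case (2 a)
    then have "v = x" using q by (auto simp: path_between_def)
    with x(2) show ?thesis by simp
  next
    case (3 a b q')
    then show ?thesis using q that[of b q'] by (simp add: path_between_def)
  qed (use q in \<open>simp add: path_between_def is_path_def\<close>)
  then have w: "{v, w} \<in> edges T" using q by (simp add: path_between_def is_path_def)
  have only: "y = w" if y: "{v, y} \<in> edges T" for y
  proof -
    obtain p1 where "p = p1 @ [y, v]" using nb[OF y] ..
    moreover obtain p2 where "p = p2 @ [w, v]" using nb[OF w] ..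
    ultimately show ?thesis by simp
  qed
  have "\<forall>e\<in>edges T. v \<in> e \<longrightarrow> e = {v, w}"
  proof (intro ballI impI)
    fix e assume e: "e \<in> edges T" "v \<in> e"
    obtain y z where yz: "e = {y, z}" by (rule simple_graph_edgeE[OF treeD(1)[OF T] e(1)])
    with e(2) have "e = {v, y} \<or> e = {v, z}" by auto
    then obtain y where y: "e = {v, y}" by blast
    with only[of y] e(1) show "e = {v, w}" by simp
  qed
  moreover have "subtree (induced T (verts T - {v})) T"
  proof (rule subtree_induced[OF T])
    show "verts T - {v} \<noteq> {}" using x by auto
    fix a b s assume a: "a \<in> verts T - {v}" and b: "b \<in> verts T - {v}" and s: "path_between T a s b"
    have "v \<notin> set s"
    proof
      assume "v \<in> set s"
      then obtain s1 s2 where eq: "s = s1 @ v # s2" by (meson split_list)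
      have "s1 \<noteq> []" "s2 \<noteq> []" using s a b eq by (auto simp: path_between_def)
      then obtain s1' y z s2' where eq': "s1 = s1' @ [y]" "s2 = z # s2'"
        by (cases s1 rule: rev_cases; cases s2) auto
      have "{y, v} \<in> edges T" "{v, z} \<in> edges T" "y \<noteq> z"
        using s eq eq' by (auto simp: path_between_def is_path_def successively_append_iff)
      then show False using only[of y] only[of z] by (simp add: insert_commute)
    qed
    then show "set s \<subseteq> verts T - {v}" using s by (auto simp: path_between_def is_path_def)
  qed simp
  ultimately show ?thesis by (rule that[OF v w])
qed

text \<open>The path from \<open>x\<close> to \<open>w\<close> inside \<open>S\<close> avoids
  \<open>v\<close>, so the edge to \<open>v\<close> prolongs it. As \<open>S\<close> is any subtree
  with \<open>w\<close> but without \<open>v\<close>, this serves both for deleting a leaf and for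
  attaching one.\<close>

lemma gdist_leaf:
  assumes T: "tree T" and e: "{v, w} \<in> edges T" and S: "subtree S T"
    and v: "v \<notin> verts S" and w: "w \<in> verts S" and x: "x \<in> verts S"
  shows "gdist T x v = Suc (gdist T x w)" "gdist T v x = Suc (gdist T x w)"
proof -
  obtain p where p: "path_between S x p w" using tree_path_ex[OF subtreeD(1)[OF S] x w] .
  have pT: "path_between T x p w" using path_between_subtree[OF S p] .
  then have lp: "is_path T p" "last p = w" "hd p = x" by (simp_all add: path_between_def)
  have "set p \<subseteq> verts S" "p \<noteq> []" using p by (simp_all add: path_between_def is_path_def)
  then have "v \<notin> set p" using v by blast
  then have "is_path T (p @ [v])"
    using is_path_append1[OF treeD(1)[OF T] lp(1), of v] e lp(2) by (simp add: insert_commute)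
  then have "path_between T x (p @ [v]) v" using lp(3) \<open>p \<noteq> []\<close> by (simp add: path_between_def)
  from tree_gdist[OF T this] tree_gdist[OF T pT] \<open>p \<noteq> []\<close>
  show *: "gdist T x v = Suc (gdist T x w)" by (cases p) simp_all
  have "gdist T v x = gdist T x v"
    using tree_gdist_sym[OF T simple_graph_edge(1)[OF treeD(1)[OF T] e]] x subtreeD(2)[OF S] by blast
  with * show "gdist T v x = Suc (gdist T x w)" by simp
qed

text \<open>A new leaf that occurs once among the four points adds 1 to all three sums.\<close>

lemma tree_four_point:
  assumes "tree T" "x \<in> verts T" "y \<in> verts T" "z \<in> verts T" "t \<in> verts T"
  shows "gdist T x y + gdist T z t
       \<le> max (gdist T x z + gdist T y t) (gdist T x t + gdist T y z)"
  using assms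
proof (induction "card (verts T)" arbitrary: T x y z t rule: less_induct)
  case less
  note T = \<open>tree T\<close>
  show ?case
  proof (cases "card (verts T) \<ge> 2")
    case False
    have "a = b" if "a \<in> verts T" "b \<in> verts T" for a b
      using False treeD(4)[OF T] that card_le_Suc0_iff_eq[of "verts T"] by auto
    with less.prems tree_gdist_self[OF T] show ?thesis
      by (metis le0 le_add_same_cancel1 max.cobounded1)
  next
    case True
    then obtain v w where v: "v \<in> verts T" "{v, w} \<in> edges T"
      and S: "subtree (induced T (verts T - {v})) T" (is "subtree ?S T")
      using tree_farthest_leaf[OF T True less.prems(2)] by metis
    have w: "w \<in> verts ?S" using simple_graph_edge[OF treeD(1)[OF T] v(2)] by auto
    have "card (verts ?S) < card (verts T)"
      using card_Diff1_less[OF treeD(4)[OF T] v(1)] by (simp only: verts_induced)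
    note IH = less.hyps[OF this subtreeD(1)[OF S]]
    define d where "d = gdist T"
    define W where "W = verts T - {v}"
    have IH': "d x y + d z t \<le> max (d x z + d y t) (d x t + d y z)"
      if "x \<in> W" "y \<in> W" "z \<in> W" "t \<in> W" for x y z t
      using IH[of x y z t] subtree_gdist[OF T S] that by (simp add: d_def W_def)
    have wW: "w \<in> W" using w by (simp add: W_def)
    have d: "d a v = Suc (d a w)" "d v a = Suc (d a w)" if "a \<in> W" for a
      using gdist_leaf[OF T v(2) S _ w] that by (auto simp: W_def d_def)
    have vv: "d v v = 0" using tree_gdist_self[OF T v(1)] by (simp add: d_def)
    have ww: "d w w = 0" using tree_gdist_self[OF T] wW by (simp add: d_def W_def)
    have sym: "d a b = d b a" if "a \<in> W" "b \<in> W" for a b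
      using tree_gdist_sym[OF T] that by (simp add: d_def W_def)
    \<comment> \<open>The triangle inequality through \<open>w\<close> is the four-point condition
      with \<open>w\<close> taken twice.\<close>
    have tri: "d a b \<le> d a w + d b w" if "a \<in> W" "b \<in> W" for a b
      using IH'[of a b w w] that wW ww by simp
    have symT: "d a b = d b a" if "a \<in> verts T" "b \<in> verts T" for a b
      using tree_gdist_sym[OF T] that by (simp add: d_def)
    have VW: "a = v \<or> a \<in> W" if "a \<in> verts T" for a
      using that by (auto simp: W_def)
    \<comment> \<open>By symmetry it suffices to treat the leaf in the first position. If
      \<open>z\<close> or \<open>t\<close> is \<open>v\<close> too, the left side is one of the two
      sums on the right; if \<open>y\<close> is \<open>v\<close>, then \<open>tri\<close>
      applies.\<close>
    have P: "d v y + d z t \<le> max (d v z + d y t) (d v t + d y z)"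
      if V: "y \<in> verts T" "z \<in> verts T" "t \<in> verts T" for y z t
    proof -
      consider "z = v" | "t = v" | "y = v" "z \<in> W" "t \<in> W" | "y \<in> W" "z \<in> W" "t \<in> W"
        using VW[of y] VW[of z] VW[of t] V by metis
      then show ?thesis
      proof cases
        case 1
        then show ?thesis using symT[of y v] V v(1) by simp
      next
        case 2
        then show ?thesis using symT[of z v] symT[of y v] V v(1) by simp
      next
        case 3
        then show ?thesis using tri[of z t] by (simp add: d vv)
      next
        case 4
        then show ?thesis using IH'[of w y z t] wW sym[of w y] sym[of w z] sym[of w t]
          by (simp add: d)
      qed
    qed
    note V = less.prems(2-5)
    consider "x = v" | "y = v" | "z = v" | "t = v" | "x \<in> W" "y \<in> W" "z \<in> W" "t \<in> W"
      using VW[of x] VW[of y] VW[of z] VW[of t] V by metis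
    then have "d x y + d z t \<le> max (d x z + d y t) (d x t + d y z)"
    proof cases
      case 1
      then show ?thesis using P V by simp
    next
      case 2
      then show ?thesis using P[of x t z] V
          symT[of x v] symT[of z t] by (simp add: add.commute)
    next
      case 3
      then show ?thesis using P[of t x y] V
          symT[of x v] symT[of y v] symT[of t x] symT[of t y] by (simp add: add.commute)
    next
      case 4
      then show ?thesis using P[of z y x] V
          symT[of z v] symT[of y v] symT[of x v] symT[of x y] symT[of z y] symT[of z x]
        by (simp add: add.commute)
    next
      case 5
      then show ?thesis using IH' by simp
    qed
    then show ?thesis by (simp add: d_def)
  qed
qed

text \<open>For a vertex \<^term>\<open>z\<close> on the path from \<^term>\<open>x\<close> to \<^term>\<open>y\<close>, apply the four-point
  condition to the pairs \<^term>\<open>(x, y)\<close> and \<^term>\<open>(c, z)\<close>.\<close>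

lemma subtree_ball:
  assumes T: "tree T" and c: "c \<in> verts T"
  shows "subtree (induced T {x \<in> verts T. gdist T c x \<le> n}) T"
proof (rule subtree_induced[OF T])
  show "{x \<in> verts T. gdist T c x \<le> n} \<noteq> {}" using c tree_gdist_self[OF T c] by auto
  fix x y p
  assume x: "x \<in> {x \<in> verts T. gdist T c x \<le> n}" and y: "y \<in> {x \<in> verts T. gdist T c x \<le> n}"
    and p: "path_between T x p y"
  show "set p \<subseteq> {x \<in> verts T. gdist T c x \<le> n}"
  proof
    fix z assume z: "z \<in> set p"
    then have zT: "z \<in> verts T" using p by (auto simp: path_between_def is_path_def)
    obtain i where i: "i < length p" "z = p ! i" using z by (metis in_set_conv_nth)
    have pp: "is_path T p" "x = p ! 0" "y = p ! (length p - 1)"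
      using p by (auto simp: path_between_def is_path_def hd_conv_nth last_conv_nth)
    have "gdist T x z = i"
      using tree_gdist_nth[OF T pp(1), of 0 i] i(1) unfolding pp(2) i(2) by simp
    moreover have "gdist T z y = length p - 1 - i"
      using tree_gdist_nth[OF T pp(1), of i "length p - 1"] i(1) unfolding pp(3) i(2) by simp
    moreover have "gdist T x y = length p - 1"
      using tree_gdist[OF T p] .
    moreover have "gdist T x y + gdist T c z
        \<le> max (gdist T x c + gdist T y z) (gdist T x z + gdist T y c)"
      using tree_four_point[OF T _ _ c zT] x y by simp
    moreover have "gdist T x c = gdist T c x" "gdist T y c = gdist T c y" "gdist T y z = gdist T z y"
      using tree_gdist_sym[OF T _ c] tree_gdist_sym[OF T _ zT] x y by simp_all
    moreover have "gdist T c x \<le> n" "gdist T c y \<le> n" using x y by simp_all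
    \<comment> \<open>The lengths of the two segments at \<open>z\<close> add up to
      \<open>gdist T x y\<close>. Cancelling bounds \<open>gdist T c z\<close> by
      \<open>gdist T c x\<close> or by \<open>gdist T c y\<close>.\<close>
    ultimately have "gdist T c z \<le> n" using i(1) by linarith
    then show "z \<in> {x \<in> verts T. gdist T c x \<le> n}" using zT by simp
  qed
qed auto

text \<open>In the four-point condition for \<open>x\<close>, \<open>y\<close>, \<open>v\<close>,
  \<open>r\<close>, the distances from \<open>r\<close> to \<open>x\<close> and \<open>y\<close> are
  at most \<open>gdist T r v\<close>. Cancelling leaves \<open>gdist T x y\<close> at most the
  larger of the distances from \<open>v\<close> to \<open>x\<close> and \<open>y\<close>.\<close>

lemma ball_at_farthest_diameter:
  assumes T: "tree T" and r: "r \<in> verts T" and v: "v \<in> verts T"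
    and far: "\<forall>x\<in>verts T. gdist T r x \<le> gdist T r v"
  shows "diameter (induced T {x \<in> verts T. gdist T v x \<le> n}) \<le> n"
proof -
  let ?B = "induced T {x \<in> verts T. gdist T v x \<le> n}"
  have S: "subtree ?B T" using subtree_ball[OF T v] .
  have "gdist T x y \<le> n"
    if "x \<in> verts T" "gdist T v x \<le> n" "y \<in> verts T" "gdist T v y \<le> n" for x y
    using tree_four_point[OF T that(1,3) v r] bspec[OF far that(1)] bspec[OF far that(3)] that
      tree_gdist_sym[OF T v that(1)] tree_gdist_sym[OF T v that(3)]
      tree_gdist_sym[OF T r that(1)] tree_gdist_sym[OF T r that(3)] tree_gdist_sym[OF T r v]
    by linarith
  then show ?thesis
    unfolding tree_diameter_le_iff[OF subtreeD(1)[OF S]]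
    using subtree_gdist[OF T S] by simp
qed

section \<open>Colorings\<close>

text \<open>The distance condition says that \<open>e\<close> and \<open>f\<close> are the end edges
  of a path with at most \<open>l + 1\<close> edges, that is, with fewer than \<open>l\<close> edges
  in between. Stated by distances, it passes between a tree and its subtrees.\<close>

definition separating :: "nat \<Rightarrow> 'a sgraph \<Rightarrow> ('a set \<Rightarrow> nat) \<Rightarrow> bool" where
  "separating l T c \<longleftrightarrow> (\<forall>e\<in>edges T. \<forall>f\<in>edges T. e \<noteq> f \<longrightarrow>
     (\<forall>x\<in>e. \<forall>y\<in>f. gdist T x y \<le> l + 1) \<longrightarrow> c e \<noteq> c f)"

text \<open>The path with end edges \<open>e\<close> and \<open>f\<close> is the only one between
  its ends, so it must itself be distance proper.\<close>

lemma proper_connecting_imp_separating: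
  assumes T: "tree T" and pc: "proper_connecting l T c"
  shows "separating l T c"
  unfolding separating_def
proof (intro ballI impI)
  fix e f assume ef: "e \<in> edges T" "f \<in> edges T" "e \<noteq> f"
    and d: "\<forall>x\<in>e. \<forall>y\<in>f. gdist T x y \<le> l + 1"
  obtain p where p: "is_path T p" "length p \<ge> 3" "path_edges p ! 0 = e"
    "path_edges p ! (length p - 2) = f"
    using tree_path_through_edges[OF T ef] .
  let ?n = "length p - 1"
  have "p ! 0 \<in> e" "p ! ?n \<in> f"
    using p nth_path_edges[of 0 p] nth_path_edges[of "length p - 2" p]
    by (auto simp: Suc_diff_le numeral_2_eq_2 Suc_diff_Suc)
  then have len: "?n \<le> l + 1" using d tree_gdist_nth[OF T p(1), of 0 ?n] p(2) by fastforce
  have "p ! 0 \<noteq> p ! ?n" using p(1,2) by (auto simp: is_path_def nth_eq_iff_index_eq)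
  moreover have pb: "path_between T (p ! 0) p (p ! ?n)"
    using p(1) by (auto simp: path_between_def is_path_def hd_conv_nth last_conv_nth)
  moreover have "p ! 0 \<in> verts T" "p ! ?n \<in> verts T"
    using p(1,2) by (auto simp: is_path_def)
  ultimately have "distance_proper l c p"
    using pc tree_path_unique[OF T pb] unfolding proper_connecting_def by metis
  \<comment> \<open>The end edges have positions \<open>0\<close> and \<open>length p - 2\<close>,
    hence \<open>length p - 3\<close> edges in between, which is less than \<open>l\<close> by
    \<open>len\<close>.\<close>
  then show "c e \<noteq> c f"
    unfolding distance_proper_def p(3,4)[symmetric] using p(2) len
    by (auto dest!: spec2[where x = 0 and y = "length p - 2"])
qed

text \<open>If fewer than \<open>l\<close> edges separate positions \<open>i < j\<close>, then all
  endpoints involved lie between \<open>p ! i\<close> and \<open>p ! Suc j\<close>, at most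
  \<open>l + 1\<close> steps apart.\<close>

lemma separating_imp_proper_connecting:
  assumes T: "tree T" and sep: "separating l T c"
  shows "proper_connecting l T c"
  unfolding proper_connecting_def
proof (intro ballI impI)
  fix u v assume "u \<in> verts T" "v \<in> verts T"
  then obtain p where p: "path_between T u p v" using tree_path_ex[OF T] by blast
  then have ip: "is_path T p" by (simp add: path_between_def)
  have "c (path_edges p ! i) \<noteq> c (path_edges p ! j)"
    if ij: "i < j" "j < length (path_edges p)" "j - i - 1 < l" for i j
  proof -
    have pe: "path_edges p ! i = {p ! i, p ! Suc i}" "path_edges p ! j = {p ! j, p ! Suc j}"
      using ij by (simp_all add: nth_path_edges)
    have "distinct p" using ip by (simp add: is_path_def)
    then have "path_edges p ! i \<noteq> path_edges p ! j"
      using ij by (auto simp: pe doubleton_eq_iff nth_eq_iff_index_eq)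
    moreover have "{p ! k, p ! Suc k} \<in> edges T" if "Suc k < length p" for k
      using ip that by (auto simp: is_path_def successively_conv_nth)
    then have "path_edges p ! i \<in> edges T" "path_edges p ! j \<in> edges T"
      using ij by (auto simp: pe)
    moreover have "\<forall>x\<in>path_edges p ! i. \<forall>y\<in>path_edges p ! j. gdist T x y \<le> l + 1"
      using ij tree_gdist_nth[OF T ip] by (auto simp: pe)
    ultimately show ?thesis using sep unfolding separating_def by blast
  qed
  then have "distance_proper l c p" unfolding distance_proper_def by blast
  with p show "\<exists>p. path_between T u p v \<and> distance_proper l c p" by blast
qed

text \<open>Any two edges of such a subtree conflict, since distances in \<open>S\<close> and
  \<open>T\<close> agree. This is the source of the lower bound.\<close>

lemma separating_inj_on_subtree:
  assumes T: "tree T" and sep: "separating l T c" and S: "subtree S T" and "diameter S \<le> l + 1"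
  shows "inj_on c (edges S)"
proof (rule inj_onI, rule ccontr)
  fix e f assume ef: "e \<in> edges S" "f \<in> edges S" "c e = c f" "e \<noteq> f"
  have "e \<subseteq> verts S" "f \<subseteq> verts S"
    using ef treeD(1)[OF subtreeD(1)[OF S]] by (auto simp: simple_graph_def)
  then have "\<forall>x\<in>e. \<forall>y\<in>f. gdist T x y \<le> l + 1"
    using assms(4) tree_diameter_le_iff[OF subtreeD(1)[OF S]] subtree_gdist[OF T S]
    by (metis subsetD)
  then show False using sep ef subtreeD(3)[OF S] unfolding separating_def by blast
qed

text \<open>All edges that conflict with the new leaf edge \<^term>\<open>{v, w}\<close> lie in the subtree \<^term>\<open>B\<close>,
  which also contains \<^term>\<open>{v, w}\<close>, so they use at most \<^term>\<open>k - 1\<close> colors.\<close>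

lemma separating_ex:
  assumes "tree T" and "\<And>S. subtree S T \<Longrightarrow> diameter S \<le> l + 1 \<Longrightarrow> graph_size S \<le> k"
  shows "\<exists>c. c ` edges T \<subseteq> {..<k} \<and> separating l T c"
  using assms
proof (induction "card (verts T)" arbitrary: T rule: less_induct)
  case less
  note T = \<open>tree T\<close>
  obtain r where r: "r \<in> verts T" using treeD(2)[OF T] by (auto simp: connected_graph_def)
  show ?case
  proof (cases "card (verts T) \<ge> 2")
    case False
    have "edges T = {}"
    proof -
      have "a = b" if "a \<in> verts T" "b \<in> verts T" for a b
        using False treeD(4)[OF T] that card_le_Suc0_iff_eq[of "verts T"] by auto
      then have "e \<notin> edges T" for e using simple_graph_edgeE[OF treeD(1)[OF T]] by metis
      then show ?thesis by blast
    qed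
    then show ?thesis by (simp add: separating_def)
  next
    case True
    obtain v w where v: "v \<in> verts T" "\<forall>x\<in>verts T. gdist T r x \<le> gdist T r v"
      "{v, w} \<in> edges T" "\<forall>e\<in>edges T. v \<in> e \<longrightarrow> e = {v, w}"
      "subtree (induced T (verts T - {v})) T"
      using tree_farthest_leaf[OF T True r] .
    let ?S = "induced T (verts T - {v})"
    have "card (verts ?S) < card (verts T)"
      using card_Diff1_less[OF treeD(4)[OF T] v(1)] by (simp only: verts_induced)
    \<comment> \<open>The bound \<open>k\<close> carries over because subtrees of \<open>?S\<close>
      are subtrees of \<open>T\<close>.\<close>
    then obtain c where c: "c ` edges ?S \<subseteq> {..<k}" "separating l ?S c"
      using less.hyps[OF _ subtreeD(1)[OF v(5)] less.prems(2)[OF subtree_trans[OF _ v(5)]]] by blast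
    have eS: "f \<in> edges ?S" if "f \<in> edges T" "f \<noteq> {v, w}" for f
    proof -
      have "f \<subseteq> verts T" using that(1) treeD(1)[OF T] by (auto simp: simple_graph_def)
      moreover have "v \<notin> f" using that v(4) by blast
      ultimately show ?thesis using that(1) by auto
    qed
    define B where "B = induced T {x \<in> verts T. gdist T v x \<le> l + 1}"
    have B: "subtree B T" "diameter B \<le> l + 1"
      using subtree_ball[OF T v(1)] ball_at_farthest_diameter[OF T r v(1,2)] by (auto simp: B_def)
    have finB: "finite (edges B)" using treeD(5)[OF subtreeD(1)[OF B(1)]] .
    have vwB: "{v, w} \<in> edges B"
      using v(1,3) simple_graph_edge[OF treeD(1)[OF T] v(3)] tree_gdist_self[OF T v(1)]
        tree_gdist_edge[OF T v(3)] by (simp add: B_def)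
    have "card (c ` (edges B - {{v, w}})) \<le> card (edges B - {{v, w}})"
      using finB by (intro card_image_le) simp
    also have "\<dots> < card (edges B)" using finB vwB by (rule card_Diff1_less)
    also have "\<dots> \<le> k" using less.prems(2)[OF B] by (simp add: graph_size_def)
    finally have "\<not> {..<k} \<subseteq> c ` (edges B - {{v, w}})"
      using finB card_mono[of "c ` (edges B - {{v, w}})" "{..<k}"] by auto
    then obtain a where a: "a < k" "a \<notin> c ` (edges B - {{v, w}})" by auto
    define c' where "c' = c({v, w} := a)"
    have new: "c f \<noteq> a" if f: "f \<in> edges T" "f \<noteq> {v, w}" "\<forall>y\<in>f. gdist T v y \<le> l + 1" for f
    proof -
      have "f \<subseteq> verts T" using f treeD(1)[OF T] by (auto simp: simple_graph_def)
      with f have "f \<in> edges B - {{v, w}}" by (auto simp: B_def)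
      with a show ?thesis by blast
    qed
    have "c' ` edges T \<subseteq> {..<k}" using c(1) eS a by (auto simp: c'_def)
    moreover have "separating l T c'"
      unfolding separating_def
    proof (intro ballI impI)
      fix e f assume ef: "e \<in> edges T" "f \<in> edges T" "e \<noteq> f"
        and d: "\<forall>x\<in>e. \<forall>y\<in>f. gdist T x y \<le> l + 1"
      have sub: "e \<subseteq> verts T" "f \<subseteq> verts T" using ef treeD(1)[OF T] by (auto simp: simple_graph_def)
      consider "e = {v, w}" | "f = {v, w}" | "e \<noteq> {v, w}" "f \<noteq> {v, w}" by blast
      then show "c' e \<noteq> c' f"
      proof cases
        case 1
        then show ?thesis using new[of f] ef d by (auto simp: c'_def)
      next
        case 2
        have "gdist T v y \<le> l + 1" if y: "y \<in> e" for y
          using 2 d y tree_gdist_sym[OF T v(1), of y] sub(1) by auto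
        then show ?thesis using new[of e] ef 2 by (auto simp: c'_def)
      next
        case 3
        then have S: "e \<in> edges ?S" "f \<in> edges ?S" using ef eS by auto
        then have sub': "e \<subseteq> verts ?S" "f \<subseteq> verts ?S" by simp_all
        have "\<forall>x\<in>e. \<forall>y\<in>f. gdist ?S x y \<le> l + 1"
        proof (intro ballI)
          fix x y assume xy: "x \<in> e" "y \<in> f"
          show "gdist ?S x y \<le> l + 1"
            using subtree_gdist[OF T v(5) subsetD[OF sub'(1) xy(1)] subsetD[OF sub'(2) xy(2)]] d xy
            by simp
        qed
        then have "c e \<noteq> c f" using c(2) S ef(3) unfolding separating_def by blast
        then show ?thesis using 3 by (simp add: c'_def)
      qed
    qed
    ultimately show ?thesis by blast
  qed
qed

text \<open>Injectivity on \<open>S\<close> bounds the number of colors from below;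
  \<open>separating_ex\<close> with \<open>k\<close> equal to \<open>graph_size S\<close> bounds it
  from above.\<close>

lemma pc1_eq_graph_size:
  assumes T: "tree T" and S: "subtree S T" "diameter S \<le> l + 1"
    and max: "\<And>R. subtree R T \<Longrightarrow> diameter R \<le> l + 1 \<Longrightarrow> graph_size R \<le> graph_size S"
  shows "pc1 l T = graph_size S"
  unfolding pc1_def
proof (rule Least_equality)
  have ge: "graph_size S \<le> card (c ` edges T)" if "proper_connecting l T c" for c
  proof -
    have "inj_on c (edges S)"
      using separating_inj_on_subtree[OF T proper_connecting_imp_separating[OF T that] S] .
    then have "graph_size S = card (c ` edges S)" by (simp add: graph_size_def card_image)
    also have "\<dots> \<le> card (c ` edges T)"
      using treeD(5)[OF T] subtreeD(3)[OF S(1)] by (intro card_mono) auto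
    finally show ?thesis .
  qed
  then show "graph_size S \<le> k"
    if "\<exists>c. proper_connecting l T c \<and> card (c ` edges T) = k" for k
    using that by blast
  obtain c where c: "c ` edges T \<subseteq> {..<graph_size S}" "separating l T c"
    using separating_ex[OF T max] by blast
  have "proper_connecting l T c" using separating_imp_proper_connecting[OF T c(2)] .
  \<comment> \<open>A palette of \<open>graph_size S\<close> colors is available, and by
    \<open>ge\<close> no fewer can be used.\<close>
  moreover from this have "card (c ` edges T) = graph_size S"
    using ge card_mono[OF _ c(1)] by (metis card_lessThan finite_lessThan le_antisym)
  ultimately show "\<exists>c. proper_connecting l T c \<and> card (c ` edges T) = graph_size S" by blast
qed

section \<open>Largest subtrees of bounded diameter\<close>

text \<open>A path from \<open>S\<close> to a vertex outside leaves \<open>S\<close> at a first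
  vertex \<open>v\<close>. Attaching \<open>v\<close> as a leaf at its predecessor \<open>w\<close>
  raises no distance inside \<open>S\<close>, and \<open>v\<close> is one step farther than
  \<open>w\<close> from everything in \<open>S\<close>.\<close>

lemma subtree_grow:
  assumes T: "tree T" and S: "subtree S T" and ne: "S \<noteq> T"
  obtains R where "subtree R T" "graph_size S < graph_size R" "diameter R \<le> Suc (diameter S)"
proof -
  have TS: "tree S" using subtreeD(1)[OF S] .
  obtain a where a: "a \<in> verts S" using treeD(2)[OF TS] by (auto simp: connected_graph_def)
  obtain b where b: "b \<in> verts T" "b \<notin> verts S"
  proof -
    have "verts S \<noteq> verts T" using subtree_eq_if_verts_eq[OF T S] ne by blast
    then show ?thesis using that subtreeD(2)[OF S] by blast
  qed
  obtain p where p: "path_between T a p b"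
    using tree_path_ex[OF T _ b(1)] a subtreeD(2)[OF S] by blast
  have "\<exists>y\<in>set p. y \<notin> verts S" using p b by (auto simp: path_between_def is_path_def)
  then obtain p1 v p2 where eq: "p = p1 @ v # p2" "v \<notin> verts S" "\<forall>y\<in>set p1. y \<in> verts S"
    by (rule split_list_first_propE) auto
  have "p1 \<noteq> []" using p a eq by (auto simp: path_between_def)
  define w where "w = last p1"
  have w: "w \<in> verts S" using eq(3) \<open>p1 \<noteq> []\<close> by (simp add: w_def)
  have "{w, v} \<in> edges T" and vT: "v \<in> verts T"
    using p \<open>p1 \<noteq> []\<close> unfolding eq(1) w_def
    by (simp_all add: path_between_def is_path_def successively_append_iff)
  then have e: "{v, w} \<in> edges T" by (simp add: insert_commute)
  note gd = gdist_leaf[OF T e S eq(2) w]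
  define R where "R = induced T (insert v (verts S))"
  \<comment> \<open>The path from \<open>x\<close> to \<open>v\<close> runs inside \<open>S\<close>
    to \<open>w\<close> and then takes the new edge; this gives the closure condition of
    \<open>subtree_induced\<close>.\<close>
  have path: "set q \<subseteq> insert v (verts S)" if x: "x \<in> verts S" and q: "path_between T x q v" for x q
  proof -
    obtain s where s: "path_between S x s w" using tree_path_ex[OF TS x w] .
    have sS: "set s \<subseteq> verts S" "s \<noteq> []" using s by (simp_all add: path_between_def is_path_def)
    have sT: "path_between T x s w" using path_between_subtree[OF S s] .
    have "is_path T s" "last s = w" using sT by (simp_all add: path_between_def)
    moreover have "v \<notin> set s" using sS(1) eq(2) by blast
    ultimately have "is_path T (s @ [v])"
      using is_path_append1[OF treeD(1)[OF T], of s v] \<open>{w, v} \<in> edges T\<close> by simp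
    then have "path_between T x (s @ [v]) v" using sT sS by (simp add: path_between_def)
    then have "q = s @ [v]" using tree_path_unique[OF T q] by blast
    with sS show ?thesis by auto
  qed
  have R: "subtree R T"
    unfolding R_def
  proof (rule subtree_induced[OF T])
    show "insert v (verts S) \<subseteq> verts T" using vT subtreeD(2)[OF S] by simp
    fix x y q
    assume x: "x \<in> insert v (verts S)" and y: "y \<in> insert v (verts S)" and q: "path_between T x q y"
    consider "x = v" "y = v" | "x = v" "y \<in> verts S" | "y = v" "x \<in> verts S"
      | "x \<in> verts S" "y \<in> verts S" using x y by auto
    then show "set q \<subseteq> insert v (verts S)"
    proof cases
      case 1
      then have "q = [v]" using tree_path_unique[OF T q] path_between_single[OF vT] by blast
      then show ?thesis by simp
    next
      case 2
      then show ?thesis using path[of y "rev q"] path_between_rev[OF q] by simp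
    next
      case 3
      then show ?thesis using path q by simp
    next
      case 4
      then obtain s where s: "path_between S x s y" using tree_path_ex[OF TS] by blast
      then have "q = s" using tree_path_unique[OF T q path_between_subtree[OF S]] by blast
      with s show ?thesis by (auto simp: path_between_def is_path_def)
    qed
  qed simp
  have "edges S \<subset> edges R"
  proof -
    have "f \<subseteq> verts S" if "f \<in> edges S" for f
      using treeD(1)[OF TS] that by (auto simp: simple_graph_def)
    moreover from this have "{v, w} \<notin> edges S" using eq(2) by blast
    ultimately show ?thesis using subtreeD(3)[OF S] e w by (auto simp: R_def)
  qed
  then have "graph_size S < graph_size R"
    using treeD(5)[OF subtreeD(1)[OF R]] by (simp add: graph_size_def psubset_card_mono)
  moreover have "diameter R \<le> Suc (diameter S)"
  proof -
    have dS: "gdist T x y \<le> diameter S" if "x \<in> verts S" "y \<in> verts S" for x y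
      using tree_diameter_le_iff[OF TS, of "diameter S"] subtree_gdist[OF T S that] that by fastforce
    have "gdist T x y \<le> Suc (diameter S)"
      if "x \<in> insert v (verts S)" "y \<in> insert v (verts S)" for x y
      using that tree_gdist_self[OF T vT] gd dS w by (auto intro: le_SucI)
    then show ?thesis
      unfolding tree_diameter_le_iff[OF subtreeD(1)[OF R]]
      using subtree_gdist[OF T R] by (simp add: R_def)
  qed
  ultimately show ?thesis using that R by blast
qed

text \<open>For a tree of diameter at most \<open>l\<close> the set under \<open>Max\<close> is
  empty; the second conjunct gives the value there, with all edges colored differently.\<close>

theorem corollary2p5:
  fixes T :: "'a sgraph" and l :: nat
  assumes "nontrivial_tree T" and "l \<ge> 1"
  shows "((\<exists>S. subtree S T \<and> diameter S = l + 1) \<longrightarrow>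
            pc1 l T = Max {graph_size S |S. subtree S T \<and> diameter S = l + 1}) \<and>
         ((\<nexists>S. subtree S T \<and> diameter S = l + 1) \<longrightarrow>
            pc1 l T = graph_size T)"
proof -
  have T: "tree T" using assms(1) by (simp add: nontrivial_tree_def)
  \<comment> \<open>Bounding the diameter by \<open>l + 1\<close> instead of fixing it makes the
    family nonempty: it contains the one-vertex subtree.\<close>
  let ?A = "{S. subtree S T \<and> diameter S \<le> l + 1}"
  have fin: "finite {S. subtree S T}" using finite_subtrees[OF T] .
  obtain r where r: "r \<in> verts T" using treeD(2)[OF T] by (auto simp: connected_graph_def)
  have A: "finite ?A" "?A \<noteq> {}"
  proof -
    show "finite ?A" using fin by (rule rev_finite_subset) auto
    have "subtree (induced T {r}) T"
    proof (rule subtree_induced[OF T])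
      fix u v p assume "u \<in> {r}" "v \<in> {r}" "path_between T u p v"
      then show "set p \<subseteq> {r}"
        using tree_path_unique[OF T _ path_between_single[OF r], of p] by simp
    qed (use r in auto)
    moreover from this have "diameter (induced T {r}) \<le> l + 1"
      using tree_diameter_le_iff[OF subtreeD(1)] tree_gdist_self[OF subtreeD(1)] by fastforce
    ultimately show "?A \<noteq> {}" by blast
  qed
  obtain S where S: "subtree S T" "diameter S \<le> l + 1"
    and max: "\<And>R. subtree R T \<Longrightarrow> diameter R \<le> l + 1 \<Longrightarrow> graph_size R \<le> graph_size S"
  proof -
    have "Max (graph_size ` ?A) \<in> graph_size ` ?A" using A by (intro Max_in) auto
    then obtain S where "S \<in> ?A" "graph_size S = Max (graph_size ` ?A)" by auto
    then show ?thesis using that[of S] A(1) by (auto intro!: Max_ge)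
  qed
  have pc: "pc1 l T = graph_size S" using pc1_eq_graph_size[OF T S max] .
  \<comment> \<open>With diameter at most \<open>l\<close>, a proper subtree \<open>S\<close> could
    grow by one vertex within the bound \<open>l + 1\<close>, against its maximality.\<close>
  have S': "diameter S = l + 1" if ne: "S \<noteq> T"
  proof (rule ccontr)
    assume "diameter S \<noteq> l + 1"
    then have "diameter S \<le> l" using S(2) by simp
    moreover obtain R where "subtree R T" "graph_size S < graph_size R"
      "diameter R \<le> Suc (diameter S)" using subtree_grow[OF T S(1) ne] .
    ultimately show False using max[of R] by simp
  qed
  show ?thesis
  proof (intro conjI impI)
    assume "\<exists>R. subtree R T \<and> diameter R = l + 1"
    \<comment> \<open>This settles the case \<open>S = T\<close>, which \<open>S'\<close> leaves
      open.\<close>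
    then have "l + 1 \<le> diameter T" using subtree_diameter_le[OF T] by metis
    then have "diameter S = l + 1" using S' S(2) by fastforce
    moreover have "finite {graph_size S |S. subtree S T \<and> diameter S = l + 1}"
      by (rule finite_subset[OF _ finite_imageI[OF fin, of graph_size]]) blast
    ultimately show "pc1 l T = Max {graph_size S |S. subtree S T \<and> diameter S = l + 1}"
      unfolding pc using S max by (intro Max_eqI[symmetric]) auto
  next
    assume "\<nexists>S. subtree S T \<and> diameter S = l + 1"
    \<comment> \<open>By \<open>S'\<close>, a proper subtree \<open>S\<close> would have the
      excluded diameter, so \<open>S = T\<close>.\<close>
    then show "pc1 l T = graph_size T" using pc S S' by metis
  qed
qed

end
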